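(* Let $\mathcal{I}$ be the binary icosahedral group. Then $\mu(\mathcal{I}\circ\mathcal{I})=120$.
   Context: For a finite group $G$, $\mu(G)$ denotes the minimal faithful permutation degree of $G$: the least non-negative integer $m$ such that $G$ embeds in $\mathrm{Sym}(m)$. In the real quaternions $\mathbb{H}$, let $Q_8=\{\pm1,\pm i,\pm j,\pm k\}$, $\omega=\frac12(-1+i+j+k)$, $\tau=\frac12(1+\sqrt5)$ and $\sigma=\frac12(\tau^{-1}+i+\tau j)$. The binary icosahedral group $\mathcal{I}$ is the group generated by $Q_8$, $\omega$ and $\sigma$; it has order $120$ and centre $\{\pm1\}$. The central product of a group $G$ with itself is $G\circ G=(G\times G)/\{(z,z): z\in Z(G)\}$; here $\mathcal{I}\circ\mathcal{I}=(\mathcal{I}\times\mathcal{I})/\langle(-1,-1)\rangle$. *)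

theory Defs
  imports Complex_Main "HOL-Algebra.Sym_Groups" "HOL-Algebra.Coset"
begin

section \<open>Real quaternions\<close>

text \<open>\<open>Quat a b c d\<close> stands for $a + bi + cj + dk$.\<close>

codatatype quat = Quat (Re_q: real) (Im_i: real) (Im_j: real) (Im_k: real)

lemma quat_eq_iff: "x = y \<longleftrightarrow> Re_q x = Re_q y \<and> Im_i x = Im_i y \<and> Im_j x = Im_j y \<and> Im_k x = Im_k y"
  by (auto intro: quat.expand)

instantiation quat :: ab_group_add
begin

primcorec zero_quat where
  "Re_q 0 = 0"
| "Im_i 0 = 0"
| "Im_j 0 = 0"
| "Im_k 0 = 0"

primcorec plus_quat where
  "Re_q (x + y) = Re_q x + Re_q y"
| "Im_i (x + y) = Im_i x + Im_i y"
| "Im_j (x + y) = Im_j x + Im_j y"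
| "Im_k (x + y) = Im_k x + Im_k y"

primcorec uminus_quat where
  "Re_q (- x) = - Re_q x"
| "Im_i (- x) = - Im_i x"
| "Im_j (- x) = - Im_j x"
| "Im_k (- x) = - Im_k x"

primcorec minus_quat where
  "Re_q (x - y) = Re_q x - Re_q y"
| "Im_i (x - y) = Im_i x - Im_i y"
| "Im_j (x - y) = Im_j x - Im_j y"
| "Im_k (x - y) = Im_k x - Im_k y"

instance
  by standard (simp_all add: quat_eq_iff)

end

text \<open>The product is Hamilton's: $i^2 = j^2 = k^2 = ijk = -1$. The inverse of \<open>x\<close> is its conjugate
  divided by its squared norm (so that \<open>inverse 0 = 0\<close>).\<close>

instantiation quat :: real_div_algebra
begin

primcorec scaleR_quat where
  "Re_q (scaleR r x) = r * Re_q x"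
| "Im_i (scaleR r x) = r * Im_i x"
| "Im_j (scaleR r x) = r * Im_j x"
| "Im_k (scaleR r x) = r * Im_k x"

primcorec one_quat where
  "Re_q 1 = 1"
| "Im_i 1 = 0"
| "Im_j 1 = 0"
| "Im_k 1 = 0"

primcorec times_quat where
  "Re_q (x * y) = Re_q x * Re_q y - Im_i x * Im_i y - Im_j x * Im_j y - Im_k x * Im_k y"
| "Im_i (x * y) = Re_q x * Im_i y + Im_i x * Re_q y + Im_j x * Im_k y - Im_k x * Im_j y"
| "Im_j (x * y) = Re_q x * Im_j y - Im_i x * Im_k y + Im_j x * Re_q y + Im_k x * Im_i y"
| "Im_k (x * y) = Re_q x * Im_k y + Im_i x * Im_j y - Im_j x * Im_i y + Im_k x * Re_q y"

primcorec inverse_quat where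
  "Re_q (inverse x) = Re_q x / ((Re_q x)\<^sup>2 + (Im_i x)\<^sup>2 + (Im_j x)\<^sup>2 + (Im_k x)\<^sup>2)"
| "Im_i (inverse x) = - Im_i x / ((Re_q x)\<^sup>2 + (Im_i x)\<^sup>2 + (Im_j x)\<^sup>2 + (Im_k x)\<^sup>2)"
| "Im_j (inverse x) = - Im_j x / ((Re_q x)\<^sup>2 + (Im_i x)\<^sup>2 + (Im_j x)\<^sup>2 + (Im_k x)\<^sup>2)"
| "Im_k (inverse x) = - Im_k x / ((Re_q x)\<^sup>2 + (Im_i x)\<^sup>2 + (Im_j x)\<^sup>2 + (Im_k x)\<^sup>2)"

definition "x div (y :: quat) = x * inverse y"

instance
proof
  fix x :: quat
  let ?n = "(Re_q x)\<^sup>2 + (Im_i x)\<^sup>2 + (Im_j x)\<^sup>2 + (Im_k x)\<^sup>2"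
  assume "x \<noteq> 0"
  then have "Re_q x \<noteq> 0 \<or> Im_i x \<noteq> 0 \<or> Im_j x \<noteq> 0 \<or> Im_k x \<noteq> 0"
    by (simp add: quat_eq_iff)
  then have "?n \<noteq> 0"
    by (smt (verit) zero_le_power2 power2_less_0 zero_eq_power2)
  then show "inverse x * x = 1" "x * inverse x = 1"
    by (simp_all add: quat_eq_iff mult.commute add_divide_distrib [symmetric] diff_divide_distrib [symmetric]
        power2_eq_square)
qed (simp_all add: quat_eq_iff divide_quat_def algebra_simps)

end

definition quat_i :: quat where "quat_i = Quat 0 1 0 0"
definition quat_j :: quat where "quat_j = Quat 0 0 1 0"
definition quat_k :: quat where "quat_k = Quat 0 0 0 1"

definition quat_units :: "quat monoid" where
  "quat_units = \<lparr>carrier = - {0}, mult = (*), one = 1\<rparr>"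

lemma group_quat_units: "group quat_units"
proof (rule groupI)
  fix x assume "x \<in> carrier quat_units"
  then show "\<exists>y\<in>carrier quat_units. y \<otimes>\<^bsub>quat_units\<^esub> x = \<one>\<^bsub>quat_units\<^esub>"
    by (intro bexI [of _ "inverse x"]) (simp_all add: quat_units_def)
qed (simp_all add: quat_units_def mult.assoc)


section \<open>The binary icosahedral group\<close>

definition Q8 :: "quat set" where
  "Q8 = {1, - 1, quat_i, - quat_i, quat_j, - quat_j, quat_k, - quat_k}"

definition \<omega> :: quat where
  "\<omega> = (1 / 2) *\<^sub>R (- 1 + quat_i + quat_j + quat_k)"

definition \<tau> :: real where
  "\<tau> = (1 + sqrt 5) / 2"

definition \<sigma> :: quat where
  "\<sigma> = (1 / 2) *\<^sub>R (of_real (inverse \<tau>) + quat_i + \<tau> *\<^sub>R quat_j)"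

definition binary_icosahedral :: "quat monoid" where
  "binary_icosahedral = quat_units\<lparr>carrier := generate quat_units (Q8 \<union> {\<omega>, \<sigma>})\<rparr>"

lemma group_binary_icosahedral: "group binary_icosahedral"
proof -
  have "0 < \<tau>"
    by (simp add: \<tau>_def add_pos_nonneg)
  then have "Q8 \<union> {\<omega>, \<sigma>} \<subseteq> carrier quat_units"
    by (simp add: quat_units_def Q8_def \<omega>_def \<sigma>_def quat_i_def quat_j_def quat_k_def of_real_def quat_eq_iff)
  then show ?thesis
    unfolding binary_icosahedral_def
    by (intro group.subgroup_imp_group group.generate_is_subgroup group_quat_units)
qed


section \<open>Central products\<close>

definition center :: "('a, 'b) monoid_scheme \<Rightarrow> 'a set" where
  "center G = {z \<in> carrier G. \<forall>g\<in>carrier G. z \<otimes>\<^bsub>G\<^esub> g = g \<otimes>\<^bsub>G\<^esub> z}"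

definition central_square :: "('a, 'b) monoid_scheme \<Rightarrow> ('a \<times> 'a) set monoid" where
  "central_square G = (G \<times>\<times> G) Mod {(z, z) | z. z \<in> center G}"

lemma central_diagonal_normal:
  fixes G (structure)
  assumes "group G"
  shows "{(z, z) | z. z \<in> center G} \<lhd> G \<times>\<times> G"
proof -
  interpret group G by fact
  interpret GG: group "G \<times>\<times> G"
    by (intro DirProd_group assms)
  have inv_center: "inv z \<in> center G" if "z \<in> center G" for z
  proof -
    have "inv z \<otimes> g = g \<otimes> inv z" if g: "g \<in> carrier G" for g
    proof -
      have z: "z \<in> carrier G" and "z \<otimes> inv g = inv g \<otimes> z"
        using \<open>z \<in> center G\<close> g by (auto simp: center_def)
      then have "inv (z \<otimes> inv g) = inv (inv g \<otimes> z)"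
        by simp
      then show ?thesis
        using z g by (simp add: inv_mult_group)
    qed
    with that show ?thesis
      by (auto simp: center_def)
  qed
  have mult_center: "y \<otimes> z \<in> center G" if "y \<in> center G" "z \<in> center G" for y z
  proof -
    have yz: "y \<in> carrier G" "z \<in> carrier G"
      and comm: "\<And>g. g \<in> carrier G \<Longrightarrow> y \<otimes> g = g \<otimes> y" "\<And>g. g \<in> carrier G \<Longrightarrow> z \<otimes> g = g \<otimes> z"
      using that by (auto simp: center_def)
    have "(y \<otimes> z) \<otimes> g = g \<otimes> (y \<otimes> z)" if g: "g \<in> carrier G" for g
    proof -
      have "(y \<otimes> z) \<otimes> g = y \<otimes> (z \<otimes> g)"
        using yz g by (simp only: m_assoc)
      also have "\<dots> = y \<otimes> (g \<otimes> z)"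
        by (simp only: comm(2) [OF g])
      also have "\<dots> = (y \<otimes> g) \<otimes> z"
        using yz g by (simp only: m_assoc)
      also have "\<dots> = (g \<otimes> y) \<otimes> z"
        by (simp only: comm(1) [OF g])
      also have "\<dots> = g \<otimes> (y \<otimes> z)"
        using yz g by (simp only: m_assoc)
      finally show ?thesis .
    qed
    with yz show ?thesis
      by (auto simp: center_def)
  qed
  have center_carrier: "z \<in> carrier G" if "z \<in> center G" for z
    using that by (simp add: center_def)
  have "subgroup {(z, z) | z. z \<in> center G} (G \<times>\<times> G)"
  proof (rule GG.subgroupI)
    show "{(z, z) | z. z \<in> center G} \<noteq> {}"
      by (auto simp: center_def)
  qed (auto simp: inv_center mult_center center_carrier assms)
  moreover have "x \<otimes>\<^bsub>G \<times>\<times> G\<^esub> h \<otimes>\<^bsub>G \<times>\<times> G\<^esub> inv\<^bsub>G \<times>\<times> G\<^esub> x \<in> {(z, z) | z. z \<in> center G}"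
    if prems: "x \<in> carrier (G \<times>\<times> G)" "h \<in> {(z, z) | z. z \<in> center G}" for x h
  proof -
    obtain a b z where x: "x = (a, b)" "a \<in> carrier G" "b \<in> carrier G"
      and h: "h = (z, z)" "z \<in> center G"
      using prems by auto
    have "c \<otimes> z \<otimes> inv c = z" if c: "c \<in> carrier G" for c
    proof -
      have "z \<in> carrier G" "c \<otimes> z = z \<otimes> c"
        using h(2) c by (auto simp: center_def)
      then show ?thesis
        using c by (simp add: m_assoc)
    qed
    with x h show ?thesis
      by (simp add: assms)
  qed
  ultimately show ?thesis
    by (simp add: GG.normal_inv_iff)
qed

lemma group_central_square: "group G \<Longrightarrow> group (central_square G)"
  unfolding central_square_def by (intro normal.factorgroup_is_group central_diagonal_normal)


section \<open>Minimal faithful permutation degree\<close>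

text \<open>Only meaningful for finite groups: \<open>LEAST\<close> is unspecified when no such \<open>m\<close> exists.\<close>

definition min_perm_degree :: "('a, 'b) monoid_scheme \<Rightarrow> nat" where
  "min_perm_degree G = (LEAST m. \<exists>f. f \<in> mon G (sym_group m))"

end

theory Submission
  imports Defs "HOL-Algebra.Sylow" "HOL-Algebra.Multiplicative_Group"
begin

text \<open>
  Write $\mathcal{I}$ for the binary icosahedral group. It acts on itself by left and right
  multiplication, and the kernel of this action of $\mathcal{I} \times \mathcal{I}$ is exactly the
  central diagonal; hence $\mathcal{I} \circ \mathcal{I}$ embeds in the symmetric group of degree
  $|\mathcal{I}| = 120$ (\<open>central_square_embeds\<close>).

  For the lower bound, a faithful action moves some point by the image of $(1,-1)$. The
  stabilizer $S$ of that point, taken in $\mathcal{I} \times \mathcal{I}$, avoids $(1,-1)$ and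
  $(-1,1)$, and its orbit has $120^2 / |S|$ points. So everything rests on $|S| \le 120$
  (\<open>card_subgroup_\<I>\<I>\<close>). Now $|S|$ is the product of the order of one projection and the order of the
  kernel of that projection, and this kernel is a subgroup of $\mathcal{I}$ without $-1$. If one of the
  two kernels is trivial, the bound is clear. Otherwise each is a nontrivial subgroup $K$ of
  $\mathcal{I}$ that does not contain $-1$, and \<open>card_subgroup_without_minus_one\<close> says that $K$ has at
  most 5 elements and that at most 24 elements of $\mathcal{I}$ normalize it. As the projections
  normalize the kernels, $|S| \le 24 \cdot 5$.

  That lemma needs no classification of subgroups. Since $-1$ is the only involution among the
  quaternions, $K$ has odd order. A Frobenius-Schur argument shows that a finite group of unit
  quaternions of odd order is commutative (\<open>odd_unit_quat_subgroup_commutative\<close>), so $K$ lies in the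
  centralizer of any of its elements. Commuting unit quaternions with equal real part are equal or
  inverse to each other, and only nine real parts occur in $\mathcal{I}$ (\<open>Re_\<I>\<close>). This bounds
  centralizers, and also the number of conjugates of an element of $K$ inside $K$.

  The group enters concretely only through its order and through the list of real parts. Both are
  read off from the normal form $\sigma^k \omega^l q$ with $k < 5$, $l < 3$ and $q \in Q_8$
  (\<open>\<I>_subset_words\<close>).
\<close>

section \<open>Counting in groups\<close>

text \<open>
  A bound of the orbit-stabilizer type without an action: a map whose fibres lie in translates of a
  finite set \<open>S\<close> cannot shrink cardinality by more than the factor \<open>|S|\<close>. It is used for orbits, for
  projections of a subgroup of a product, and for conjugates of a single element.
\<close>

lemma (in group) card_le_card_fibres:
  assumes A: "A \<subseteq> carrier G" and X: "finite X" "\<And>g. g \<in> A \<Longrightarrow> \<phi> g \<in> X" and S: "finite S"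
    and fib: "\<And>g h. g \<in> A \<Longrightarrow> h \<in> A \<Longrightarrow> \<phi> g = \<phi> h \<Longrightarrow> inv g \<otimes> h \<in> S"
  shows "card A \<le> card X * card S"
proof -
  define r where "r x = (SOME g. g \<in> A \<and> \<phi> g = x)" for x
  have r: "r (\<phi> g) \<in> A \<and> \<phi> (r (\<phi> g)) = \<phi> g" if "g \<in> A" for g
    unfolding r_def using that by (rule_tac someI[of "\<lambda>h. h \<in> A \<and> \<phi> h = \<phi> g" g]) simp
  have "inj_on (\<lambda>g. (\<phi> g, inv (r (\<phi> g)) \<otimes> g)) A"
  proof (rule inj_onI, clarsimp)
    fix g h assume gh: "g \<in> A" "h \<in> A" and "\<phi> g = \<phi> h" "inv r (\<phi> h) \<otimes> g = inv r (\<phi> h) \<otimes> h"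
    moreover have "r (\<phi> h) \<in> carrier G" using r[of h] gh A by auto
    moreover have "g \<in> carrier G" "h \<in> carrier G" using gh A by auto
    ultimately show "g = h" by simp
  qed
  moreover have "(\<lambda>g. (\<phi> g, inv (r (\<phi> g)) \<otimes> g)) ` A \<subseteq> X \<times> S"
    using X r fib by auto
  ultimately have "card A \<le> card (X \<times> S)"
    using X S by (intro card_inj_on_le) auto
  then show ?thesis by (simp add: card_cartesian_product)
qed

text \<open>
  Left multiplication by a generator is injective, so it permutes a finite set that it maps into
  itself; hence inverses of generators preserve the set as well, and the whole group maps \<open>\<one>\<close> into it.
\<close>

lemma (in group) generate_subset_of_closed_set:
  assumes A: "A \<subseteq> carrier G" and U: "finite U" "U \<subseteq> carrier G" "\<one> \<in> U"
    and cl: "\<And>a u. a \<in> A \<Longrightarrow> u \<in> U \<Longrightarrow> a \<otimes> u \<in> U"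
  shows "generate G A \<subseteq> U"
proof -
  define S where "S = {g \<in> carrier G. \<forall>u\<in>U. g \<otimes> u \<in> U}"
  have inv_S: "inv g \<in> S" if "g \<in> S" for g
  proof -
    have g: "g \<in> carrier G" "(\<lambda>u. g \<otimes> u) ` U \<subseteq> U" using that by (auto simp: S_def)
    have "inj_on (\<lambda>u. g \<otimes> u) U"
      using g U by (intro inj_onI) (auto simp: subset_iff)
    then have surj: "(\<lambda>u. g \<otimes> u) ` U = U"
      using U g by (intro endo_inj_surj) auto
    have "inv g \<otimes> u \<in> U" if "u \<in> U" for u
    proof -
      from that surj obtain v where v: "v \<in> U" "u = g \<otimes> v" by blast
      then have "inv g \<otimes> u = v" using g U by (auto simp: m_assoc[symmetric])
      with v show ?thesis by simp
    qed
    with g show ?thesis by (auto simp: S_def)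
  qed
  have "subgroup S G"
    using U inv_S by (intro subgroupI) (auto simp: S_def m_assoc subset_iff)
  moreover have "A \<subseteq> S" using A cl by (auto simp: S_def)
  ultimately have "generate G A \<subseteq> S" by (intro generate_subgroup_incl)
  then show ?thesis using U by (fastforce simp: S_def)
qed

section \<open>Quaternions of norm one\<close>

definition sqnorm :: "quat \<Rightarrow> real" where
  "sqnorm x = (Re_q x)\<^sup>2 + (Im_i x)\<^sup>2 + (Im_j x)\<^sup>2 + (Im_k x)\<^sup>2"

lemma sqnorm_mult: "sqnorm (x * y) = sqnorm x * sqnorm y"
  by (simp add: sqnorm_def power2_eq_square algebra_simps)

lemma of_real_quat_sel [simp]:
  "Re_q (of_real r) = r" "Im_i (of_real r) = 0" "Im_j (of_real r) = 0" "Im_k (of_real r) = 0"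
  by (simp_all add: of_real_def)

lemma quat_numeral_sel [simp]:
  "Re_q (numeral n) = numeral n" "Im_i (numeral n) = 0" "Im_j (numeral n) = 0" "Im_k (numeral n) = 0"
  using of_real_quat_sel[of "numeral n"] by simp_all

lemma quat_unit_sel [simp]:
  "Re_q quat_i = 0" "Im_i quat_i = 1" "Im_j quat_i = 0" "Im_k quat_i = 0"
  "Re_q quat_j = 0" "Im_i quat_j = 0" "Im_j quat_j = 1" "Im_k quat_j = 0"
  "Re_q quat_k = 0" "Im_i quat_k = 0" "Im_j quat_k = 0" "Im_k quat_k = 1"
  by (simp_all add: quat_i_def quat_j_def quat_k_def)

lemma sqnorm_1 [simp]: "sqnorm 1 = 1" by (simp add: sqnorm_def)

lemma inverse_unit_quat:
  assumes "sqnorm x = 1"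
  shows "inverse x = of_real (2 * Re_q x) - x"
  using assms by (simp add: quat_eq_iff sqnorm_def)

lemma square_unit_quat:
  assumes "sqnorm x = 1"
  shows "x * x = (2 * Re_q x) *\<^sub>R x - 1"
  using assms by (simp add: quat_eq_iff sqnorm_def power2_eq_square algebra_simps)

text \<open>
  Both \<open>y\<close> and \<open>z\<close> are roots of the real quadratic $t^2 - 2rt + 1$, where $r$ is the common real part.
  Over a commutative subfield it factors as $(t - y)(t - y^{-1})$.
\<close>

lemma commuting_units_same_Re:
  assumes y: "sqnorm y = 1" and z: "sqnorm z = 1" and "y * z = z * y" and re: "Re_q z = Re_q y"
  shows "z = y \<or> z = inverse y"
proof -
  have "y \<noteq> 0" using y by (auto simp: sqnorm_def)
  have "(z - y) * (z - inverse y) = z * z - z * inverse y - y * z + y * inverse y"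
    by (simp add: algebra_simps)
  also have "\<dots> = 0"
    using \<open>y * z = z * y\<close> \<open>y \<noteq> 0\<close>
    by (simp add: square_unit_quat[OF z] re, simp add: inverse_unit_quat[OF y] algebra_simps scaleR_conv_of_real)
      (simp add: quat_eq_iff algebra_simps)
  finally show ?thesis by simp
qed

lemma unit_quat_real:
  assumes "sqnorm x = 1" "Im_i x = 0" "Im_j x = 0" "Im_k x = 0"
  shows "x = 1 \<or> x = - 1"
  using assms by (auto simp: sqnorm_def quat_eq_iff power2_eq_1_iff)

text \<open>
  To commute with \<open>s\<close> is to have an imaginary part whose cross product with that of \<open>s\<close> vanishes, so the
  centralizer of a nonreal quaternion is the plane spanned by \<open>1\<close> and \<open>s\<close>.
\<close>

lemma commute_with_nonreal:
  fixes x s :: quat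
  assumes "x * s = s * x" "s \<notin> range of_real"
  obtains a b where "x = of_real a + b *\<^sub>R s"
proof -
  have c: "Im_i x * Im_j s = Im_j x * Im_i s" "Im_i x * Im_k s = Im_k x * Im_i s" "Im_j x * Im_k s = Im_k x * Im_j s"
    using assms(1) by (auto simp: quat_eq_iff algebra_simps)
  have "s \<noteq> of_real (Re_q s)" using assms(2) by blast
  then consider "Im_i s \<noteq> 0" | "Im_j s \<noteq> 0" | "Im_k s \<noteq> 0" by (auto simp: quat_eq_iff)
  then have "\<exists>b. Im_i x = b * Im_i s \<and> Im_j x = b * Im_j s \<and> Im_k x = b * Im_k s"
  proof cases
    case 1 then show ?thesis using c by (intro exI[of _ "Im_i x / Im_i s"]) (simp add: field_simps)
  next
    case 2 then show ?thesis using c by (intro exI[of _ "Im_j x / Im_j s"]) (simp add: field_simps)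
  next
    case 3 then show ?thesis using c by (intro exI[of _ "Im_k x / Im_k s"]) (simp add: field_simps)
  qed
  then obtain b where b: "Im_i x = b * Im_i s" "Im_j x = b * Im_j s" "Im_k x = b * Im_k s" by blast
  show thesis
    by (rule that[of "Re_q x - b * Re_q s" b]) (simp add: quat_eq_iff b)
qed

lemma centralizer_commutes:
  fixes x y s :: quat
  assumes "x * s = s * x" "y * s = s * y" "s \<notin> range of_real"
  shows "x * y = y * x"
proof -
  obtain a b where x: "x = of_real a + b *\<^sub>R s" using commute_with_nonreal[OF assms(1,3)] .
  obtain c d where y: "y = of_real c + d *\<^sub>R s" using commute_with_nonreal[OF assms(2,3)] .
  show ?thesis unfolding x y by (simp add: quat_eq_iff algebra_simps)
qed

section \<open>Finite groups of quaternions without $-1$\<close>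

lemma Re_q_sum: "Re_q (\<Sum>x\<in>A. f x) = (\<Sum>x\<in>A. Re_q (f x))"
  by (induction A rule: infinite_finite_induct) simp_all

lemma quat_units_simps [simp]:
  "carrier quat_units = - {0}" "x \<otimes>\<^bsub>quat_units\<^esub> y = x * y" "\<one>\<^bsub>quat_units\<^esub> = 1"
  by (simp_all add: quat_units_def)

lemma inv_quat_units [simp]: "x \<noteq> 0 \<Longrightarrow> inv\<^bsub>quat_units\<^esub> x = inverse x"
  by (rule group.inv_equality[OF group_quat_units]) auto

lemma quat_subgroupD:
  assumes "subgroup K quat_units"
  shows "0 \<notin> K" "1 \<in> K" "x \<in> K \<Longrightarrow> y \<in> K \<Longrightarrow> x * y \<in> K" "x \<in> K \<Longrightarrow> inverse x \<in> K"
proof -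
  interpret subgroup K quat_units by fact
  show 0: "0 \<notin> K" using subset by auto
  show "1 \<in> K" using one_closed by simp
  show "x \<in> K \<Longrightarrow> y \<in> K \<Longrightarrow> x * y \<in> K" using m_closed[of x y] by simp
  assume "x \<in> K"
  moreover from this 0 have "x \<noteq> 0" by auto
  ultimately show "inverse x \<in> K" using m_inv_closed[of x] by simp
qed

lemma pow_quat_units: "x [^]\<^bsub>quat_units\<lparr>carrier := K\<rparr>\<^esub> (n :: nat) = x ^ n"
  by (induction n) (simp_all add: power_commutes)

lemma quat_subgroup_power_card:
  assumes K: "subgroup K quat_units" "finite K" "x \<in> K"
  shows "x ^ card K = 1"
proof -
  interpret K: group "quat_units\<lparr>carrier := K\<rparr>"
    by (rule group.subgroup_imp_group[OF group_quat_units K(1)])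
  show ?thesis
    using K.pow_order_eq_1[of x] K by (simp add: order_def pow_quat_units)
qed

lemma card_subgroup_dvd:
  assumes "subgroup H quat_units" "subgroup K quat_units" "H \<subseteq> K"
  shows "card H dvd card K"
proof -
  have "subgroup H (quat_units\<lparr>carrier := K\<rparr>)"
    using group.subgroup_incl[OF group_quat_units] assms by blast
  from group.lagrange[OF group.subgroup_imp_group[OF group_quat_units assms(2)] this]
  show ?thesis by (simp add: order_def) (metis dvd_triv_right)
qed

lemma prime_dvd_card_of_order:
  assumes K: "subgroup K quat_units" "finite K" and x: "x \<in> K" "x \<noteq> 1" "x ^ p = 1" and p: "prime (p::nat)"
  shows "p dvd card K"
proof -
  interpret K: group "quat_units\<lparr>carrier := K\<rparr>"
    by (rule group.subgroup_imp_group[OF group_quat_units K(1)])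
  have "K.ord x dvd p" using K.pow_eq_id[of x p] x by (simp add: pow_quat_units)
  moreover have "K.ord x \<noteq> 1" using K.ord_eq_1[of x] x by simp
  ultimately have "K.ord x = p" using p prime_nat_iff by blast
  then show ?thesis using K.ord_dvd_group_order[of x] x by (simp add: order_def)
qed

text \<open>
  A group of even order contains an involution, and in a division ring the only solutions of
  $h^2 = 1$ are $\pm 1$.
\<close>

lemma odd_card_of_no_minus_one:
  assumes K: "subgroup K quat_units" "finite K" "- 1 \<notin> K"
  shows "odd (card K)"
proof
  assume "even (card K)"
  then obtain m where m: "card K = 2 ^ 1 * m" by (auto elim: evenE)
  have grp: "group (quat_units\<lparr>carrier := K\<rparr>)"
    by (rule group.subgroup_imp_group[OF group_quat_units K(1)])
  obtain H where H: "subgroup H (quat_units\<lparr>carrier := K\<rparr>)" "card H = 2"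
    using sylow_thm[OF two_is_prime_nat grp, of 1 m] m K by (auto simp: order_def)
  interpret H: subgroup H "quat_units\<lparr>carrier := K\<rparr>" by fact
  have "1 \<in> H" using H.one_closed by simp
  then obtain h where h: "H = {1, h}" "h \<noteq> 1" using H(2) unfolding card_2_iff by auto
  have "h \<noteq> 0" using H.subset quat_subgroupD(1)[OF K(1)] h by auto
  have "h * h \<in> H" using H.m_closed[of h h] h by simp
  then have "h * h = 1" using h \<open>h \<noteq> 0\<close> by auto
  then have "(h - 1) * (h + 1) = 0" by (simp add: algebra_simps)
  then have "h = - 1" using h by (simp add: eq_neg_iff_add_eq_0)
  with H.subset h K show False by auto
qed

text \<open>
  Conjugation by $i$ fixes the $i$-component and negates the $j$- and $k$-components, and likewise for
  $j$ and $k$; so in the sum over the four basis quaternions the imaginary parts cancel.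
\<close>

lemma conj_average_identity:
  "x + quat_i * x * inverse quat_i + quat_j * x * inverse quat_j + quat_k * x * inverse quat_k = of_real (4 * Re_q x)"
  by (simp add: quat_eq_iff)

lemma Re_q_mult_commute: "Re_q (x * y) = Re_q (y * x)" by simp

text \<open>
  This is the Frobenius-Schur indicator in elementary form. If the group \<open>K\<close> is not commutative, then
  the average of \<open>g * e * inverse g\<close> over \<open>K\<close> commutes with two elements that do not commute with
  each other, so it is real (Schur's lemma) and equals the real part of \<open>e\<close>. Summing over
  $e = 1, i, j, k$ and interchanging the two sums gives $4 \sum_g (\mathrm{Re}\, g)^2 = |K|$. On the
  other hand squaring permutes a group of odd order, so $\sum_g g^2 = \sum_g g = 0$, and
  $\mathrm{Re}\, g^2 = 2 (\mathrm{Re}\, g)^2 - 1$ gives $2 \sum_g (\mathrm{Re}\, g)^2 = |K|$.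
\<close>

lemma odd_unit_quat_subgroup_commutative:
  assumes K: "subgroup K quat_units" "finite K" and nrm: "\<And>g. g \<in> K \<Longrightarrow> sqnorm g = 1"
    and odd: "odd (card K)" and xy: "x \<in> K" "y \<in> K"
  shows "x * y = y * x"
proof (rule ccontr)
  assume nc: "x * y \<noteq> y * x"
  note KD = quat_subgroupD[OF K(1)]
  have nz: "g \<noteq> 0" if "g \<in> K" for g using KD(1) that by auto
  have bij: "bij_betw ((*) h) K K" if h: "h \<in> K" for h
    by (rule bij_betw_byWitness[where f' = "(*) (inverse h)"])
      (use h nz[OF h] KD in \<open>auto simp: mult.assoc[symmetric]\<close>)
  have real: "s \<in> range of_real" if "\<And>h. h \<in> K \<Longrightarrow> h * s = s * h" for s :: quat
    using centralizer_commutes[OF that[OF xy(1)] that[OF xy(2)]] nc by blast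
  \<comment> \<open>Schur's lemma: the average of the conjugates of \<open>e\<close> is real.\<close>
  define A where "A e = (\<Sum>g\<in>K. g * e * inverse g)" for e
  have A: "A e = of_real (card K * Re_q e)" for e
  proof -
    have "h * A e = A e * h" if h: "h \<in> K" for h
    proof -
      have "A e = (\<Sum>g\<in>K. (h * g) * e * inverse (h * g))"
        unfolding A_def by (rule sum.reindex_bij_betw[OF bij[OF h], symmetric])
      also have "\<dots> = h * A e * inverse h"
        unfolding A_def sum_distrib_left sum_distrib_right
        by (intro sum.cong) (auto simp: nonzero_inverse_mult_distrib nz h mult.assoc)
      finally have "A e * h = h * A e * inverse h * h" by simp
      then show ?thesis using nz[OF h] by (simp add: mult.assoc)
    qed
    then obtain r where r: "A e = of_real r" using real by blast
    have "Re_q (g * e * inverse g) = Re_q e" if "g \<in> K" for g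
      using nz[OF that] by (subst Re_q_mult_commute) (simp only: mult.assoc[symmetric] left_inverse, simp)
    then have "Re_q (A e) = card K * Re_q e"
      unfolding A_def Re_q_sum by simp
    then show ?thesis using r by simp
  qed
  \<comment> \<open>First evaluation of the sum of the squared real parts: all terms but the first vanish, because
    $i$, $j$, $k$ have real part 0.\<close>
  have "of_real (card K) = A 1 + A quat_i * inverse quat_i + A quat_j * inverse quat_j + A quat_k * inverse quat_k"
    by (simp add: A)
  also have "\<dots> = (\<Sum>g\<in>K. g * of_real (4 * Re_q g))"
  proof -
    have "A 1 + A quat_i * inverse quat_i + A quat_j * inverse quat_j + A quat_k * inverse quat_k
      = (\<Sum>g\<in>K. g * (inverse g + quat_i * inverse g * inverse quat_i
          + quat_j * inverse g * inverse quat_j + quat_k * inverse g * inverse quat_k))"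
      unfolding A_def sum_distrib_right sum.distrib[symmetric]
      by (intro sum.cong refl) (simp only: distrib_left mult.assoc mult_1_left)
    moreover have "Re_q (inverse g) = Re_q g" if "g \<in> K" for g
      using nrm[OF that] by (simp add: sqnorm_def)
    ultimately show ?thesis by (simp only: conj_average_identity cong: sum.cong)
  qed
  finally have "of_real (card K) = (\<Sum>g\<in>K. g * of_real (4 * Re_q g))" .
  from arg_cong[OF this, of Re_q] have four: "card K = 4 * (\<Sum>g\<in>K. (Re_q g)\<^sup>2)"
    by (simp add: Re_q_sum sum_distrib_left power2_eq_square mult_ac del: of_real_mult of_real_of_nat_eq)
  \<comment> \<open>Second evaluation: translation by $x \neq 1$ fixes the sum of all elements, which is therefore 0, and
    squaring permutes the elements, so that the sum of the squares is 0 as well.\<close>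
  have "x * \<Sum>K = \<Sum>K"
    unfolding sum_distrib_left by (rule sum.reindex_bij_betw[OF bij[OF xy(1)]])
  then have "(x - 1) * \<Sum>K = 0" by (simp add: algebra_simps)
  moreover have "x \<noteq> 1" using nc by auto
  ultimately have sum0: "\<Sum>K = 0" by simp
  from odd obtain k where k: "card K = 2 * k + 1" by (auto elim: oddE)
  have "(g * g) ^ (k + 1) = g" if "g \<in> K" for g
  proof -
    have "(g * g) ^ (k + 1) = g ^ (2 * (k + 1))" by (simp only: power_mult power2_eq_square)
    also have "\<dots> = g ^ card K * g" by (simp add: k mult.assoc power_commutes)
    finally show ?thesis using quat_subgroup_power_card[OF K that] by simp
  qed
  then have "inj_on (\<lambda>g. g * g) K" by (rule inj_on_inverseI)
  then have "bij_betw (\<lambda>g. g * g) K K"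
    using endo_inj_surj[of K "\<lambda>g. g * g"] K KD by (auto simp: bij_betw_def)
  then have "(\<Sum>g\<in>K. g * g) = 0"
    using sum.reindex_bij_betw[of "\<lambda>g. g * g" K K "\<lambda>g. g"] sum0 by simp
  then have "Re_q (\<Sum>g\<in>K. g * g) = 0" by simp
  moreover have "Re_q (g * g) = 2 * (Re_q g)\<^sup>2 - 1" if "g \<in> K" for g
    using square_unit_quat[OF nrm[OF that]] by (simp add: power2_eq_square)
  ultimately have "2 * (\<Sum>g\<in>K. (Re_q g)\<^sup>2) = card K"
    unfolding Re_q_sum by (simp add: sum_subtractf sum_distrib_left[symmetric] del: times_quat.simps)
  with four have "card K = 0" by simp
  then show False using K xy by auto
qed

section \<open>The 120 elements of the binary icosahedral group\<close>

abbreviation \<I> :: "quat set" where "\<I> \<equiv> carrier binary_icosahedral"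

lemma \<omega>_eq: "\<omega> = Quat (-1/2) (1/2) (1/2) (1/2)"
  by (simp add: \<omega>_def quat_eq_iff)

lemma sqrt5_sq [simp]: "sqrt 5 * (sqrt 5 * x) = 5 * x"
  by (simp add: mult.assoc[symmetric])

lemma inverse_\<tau>: "inverse \<tau> = (sqrt 5 - 1) / 2"
  by (rule inverse_unique) (simp add: \<tau>_def field_simps)

lemma \<sigma>_eq: "\<sigma> = Quat ((sqrt 5 - 1) / 4) (1/2) ((1 + sqrt 5) / 4) 0"
  by (simp add: \<sigma>_def quat_eq_iff inverse_\<tau> del: of_real_divide of_real_diff of_real_inverse) (simp add: \<tau>_def)

lemma \<omega>_powers: "\<omega> ^ 2 = Quat (-1/2) (-1/2) (-1/2) (-1/2)" "\<omega> ^ 3 = 1"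
proof -
  show "\<omega> ^ 2 = Quat (-1/2) (-1/2) (-1/2) (-1/2)"
    by (simp add: power2_eq_square \<omega>_eq quat_eq_iff)
  then show "\<omega> ^ 3 = 1"
    by (simp add: power3_eq_cube power2_eq_square) (simp add: \<omega>_eq quat_eq_iff)
qed

lemma \<sigma>_powers:
  "\<sigma> ^ 2 = Quat (- (1 + sqrt 5) / 4) ((sqrt 5 - 1) / 4) (1/2) 0"
  "\<sigma> ^ 3 = Quat (- (1 + sqrt 5) / 4) (- (sqrt 5 - 1) / 4) (-1/2) 0"
  "\<sigma> ^ 4 = Quat ((sqrt 5 - 1) / 4) (-1/2) (- (1 + sqrt 5) / 4) 0"
  "\<sigma> ^ 5 = 1"
proof -
  show 2: "\<sigma> ^ 2 = Quat (- (1 + sqrt 5) / 4) ((sqrt 5 - 1) / 4) (1/2) 0"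
    by (simp add: power2_eq_square \<sigma>_eq quat_eq_iff field_simps)
  have "\<sigma> ^ 3 = \<sigma> * \<sigma> ^ 2" by (simp add: eval_nat_numeral)
  then show 3: "\<sigma> ^ 3 = Quat (- (1 + sqrt 5) / 4) (- (sqrt 5 - 1) / 4) (-1/2) 0"
    unfolding 2 by (simp add: \<sigma>_eq quat_eq_iff field_simps)
  have "\<sigma> ^ 4 = \<sigma> * \<sigma> ^ 3" by (simp add: eval_nat_numeral)
  then show 4: "\<sigma> ^ 4 = Quat ((sqrt 5 - 1) / 4) (-1/2) (- (1 + sqrt 5) / 4) 0"
    unfolding 3 by (simp add: \<sigma>_eq quat_eq_iff field_simps)
  have "\<sigma> ^ 5 = \<sigma> * \<sigma> ^ 4" by (simp add: eval_nat_numeral)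
  then show "\<sigma> ^ 5 = 1"
    unfolding 4 by (simp add: \<sigma>_eq quat_eq_iff field_simps)
qed

text \<open>
  Conjugation by \<open>\<omega>\<close> permutes $i, j, k$ cyclically, so left multiplication by $i$ and $j$ permutes the
  cosets $\omega^l Q_8$.
\<close>

lemma \<omega>_relations:
  "quat_i * \<omega> = \<omega> * quat_j" "quat_i * \<omega>\<^sup>2 = \<omega>\<^sup>2 * quat_k"
  "quat_j * \<omega> = \<omega> * quat_k" "quat_j * \<omega>\<^sup>2 = \<omega>\<^sup>2 * quat_i"
  by (simp_all only: \<omega>_powers) (simp_all add: quat_eq_iff \<omega>_eq)

text \<open>
  The binary tetrahedral group $\langle Q_8, \omega\rangle$ has index 5, with coset representatives the
  powers of \<open>\<sigma>\<close>. The relations record how $i$, $j$ and \<open>\<omega>\<close> permute the cosets; modulo $\pm 1$ this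
  is the action of the alternating group of degree 5 on five points.
\<close>

lemma \<sigma>_relations:
  "quat_i * \<sigma> = \<sigma>\<^sup>2 * (\<omega>\<^sup>2 * quat_k)"
  "quat_i * \<sigma>\<^sup>2 = \<sigma> * (\<omega> * quat_i)"
  "quat_i * \<sigma> ^ 3 = \<sigma> ^ 4 * (\<omega> * - quat_k)"
  "quat_i * \<sigma> ^ 4 = \<sigma> ^ 3 * (\<omega>\<^sup>2 * - quat_j)"
  "quat_j * \<sigma> = \<sigma> ^ 3 * (\<omega>\<^sup>2 * quat_i)"
  "quat_j * \<sigma>\<^sup>2 = \<sigma> ^ 4 * (\<omega> * - 1)"
  "quat_j * \<sigma> ^ 3 = \<sigma> * (\<omega> * quat_j)"
  "quat_j * \<sigma> ^ 4 = \<sigma>\<^sup>2 * \<omega>\<^sup>2"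
  "\<omega> * \<sigma> = \<sigma>\<^sup>2 * (\<omega> * - quat_j)"
  "\<omega> * \<sigma>\<^sup>2 = \<sigma> ^ 3 * (\<omega>\<^sup>2 * - 1)"
  "\<omega> * \<sigma> ^ 3 = \<sigma> * - quat_j"
  "\<omega> * \<sigma> ^ 4 = \<sigma> ^ 4 * (\<omega>\<^sup>2 * - quat_i)"
  by (simp_all only: \<omega>_powers \<sigma>_powers) (simp_all add: quat_eq_iff \<sigma>_eq \<omega>_eq field_simps)

lemma Q8_mult: "x \<in> Q8 \<Longrightarrow> y \<in> Q8 \<Longrightarrow> x * y \<in> Q8"
  unfolding Q8_def by (elim insertE emptyE; simp add: quat_eq_iff)

lemma card_Q8: "card Q8 = 8"
  by (simp add: Q8_def quat_eq_iff card_insert_if)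

lemma Q8_nonzero: "x \<in> Q8 \<Longrightarrow> x \<noteq> 0"
  unfolding Q8_def by (elim insertE emptyE; simp add: quat_eq_iff)

lemma subgroup_Q8: "subgroup Q8 quat_units"
proof (rule group.subgroupI[OF group_quat_units])
  show "inv\<^bsub>quat_units\<^esub> x \<in> Q8" if "x \<in> Q8" for x
    using that Q8_nonzero[OF that] unfolding Q8_def
    by (elim insertE emptyE) (simp_all, simp_all add: quat_eq_iff)
qed (use Q8_nonzero[of 0] in \<open>auto simp: Q8_mult\<close>, auto simp: Q8_def)

text \<open>
  Normal forms: at most $3 \cdot 8$ words $\omega^l q$ and at most $5 \cdot 24$ words
  $\sigma^k \omega^l q$ describe the groups generated by $Q_8$ and \<open>\<omega>\<close>, and by $Q_8$, \<open>\<omega>\<close> and \<open>\<sigma>\<close>.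
\<close>

definition tetrahedral_words :: "quat set" where
  "tetrahedral_words = (\<lambda>(l, q). \<omega> ^ l * q) ` ({..<3} \<times> Q8)"

definition icosahedral_words :: "quat set" where
  "icosahedral_words = (\<lambda>(k, t). \<sigma> ^ k * t) ` ({..<5} \<times> tetrahedral_words)"

lemma tetrahedral_wordsI: "l < 3 \<Longrightarrow> q \<in> Q8 \<Longrightarrow> \<omega> ^ l * q \<in> tetrahedral_words"
  unfolding tetrahedral_words_def by force

lemma tetrahedral_wordsE:
  assumes "t \<in> tetrahedral_words"
  obtains q where "q \<in> Q8" "t = q" | q where "q \<in> Q8" "t = \<omega> * q" | q where "q \<in> Q8" "t = \<omega>\<^sup>2 * q"
proof -
  obtain l q where "q \<in> Q8" "l < 3" "t = \<omega> ^ l * q"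
    using assms unfolding tetrahedral_words_def by auto
  moreover from \<open>l < 3\<close> have "l = 0 \<or> l = 1 \<or> l = 2" by auto
  ultimately show thesis using that by auto
qed

lemma tetrahedral_words_intros:
  assumes "q \<in> Q8"
  shows "q \<in> tetrahedral_words" "\<omega> * q \<in> tetrahedral_words" "\<omega>\<^sup>2 * q \<in> tetrahedral_words"
  using tetrahedral_wordsI[of 0 q] tetrahedral_wordsI[of 1 q] tetrahedral_wordsI[of 2 q] assms by auto

lemma Q8_members: "1 \<in> Q8" "- 1 \<in> Q8" "quat_i \<in> Q8" "quat_j \<in> Q8" "quat_k \<in> Q8"
    "- quat_i \<in> Q8" "- quat_j \<in> Q8" "- quat_k \<in> Q8"
  by (simp_all add: Q8_def)

text \<open>
  $Q_8$ is generated by $i$ and $j$ as a monoid.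
\<close>

lemma closed_under_Q8:
  assumes "\<And>u. u \<in> U \<Longrightarrow> quat_i * u \<in> U" "\<And>u. u \<in> U \<Longrightarrow> quat_j * u \<in> U" "q \<in> Q8" "u \<in> U"
  shows "q * u \<in> U"
proof -
  have ij: "quat_i * (quat_i * x) = - x" "quat_i * (quat_j * x) = quat_k * x" for x
    by (simp_all add: quat_eq_iff)
  have k: "quat_k * u \<in> U" if "u \<in> U" for u
    using assms(1)[OF assms(2)[OF that]] by (simp add: ij)
  have m: "- u \<in> U" if "u \<in> U" for u
    using assms(1)[OF assms(1)[OF that]] by (simp add: ij)
  show ?thesis using assms k m by (auto simp: Q8_def)
qed

lemma tetrahedral_words_closed:
  assumes t: "t \<in> tetrahedral_words"
  shows "q \<in> Q8 \<Longrightarrow> q * t \<in> tetrahedral_words" "\<omega> * t \<in> tetrahedral_words"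
proof -
  show "\<omega> * t \<in> tetrahedral_words"
    using t
  proof (cases rule: tetrahedral_wordsE)
    case (3 q)
    then have "\<omega> * t = \<omega> ^ 3 * q" by (simp only: power3_eq_cube power2_eq_square mult.assoc)
    then show ?thesis using 3 by (simp add: \<omega>_powers tetrahedral_words_intros)
  qed (auto simp: tetrahedral_words_intros mult.assoc[symmetric] power2_eq_square[symmetric])
  assume "q \<in> Q8"
  from _ _ this t show "q * t \<in> tetrahedral_words"
  proof (rule closed_under_Q8)
    show "quat_i * u \<in> tetrahedral_words" if "u \<in> tetrahedral_words" for u
      using that by (elim tetrahedral_wordsE; simp add: mult.assoc[symmetric] \<omega>_relations;
          simp add: mult.assoc tetrahedral_words_intros Q8_mult Q8_members)
    show "quat_j * u \<in> tetrahedral_words" if "u \<in> tetrahedral_words" for u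
      using that by (elim tetrahedral_wordsE; simp add: mult.assoc[symmetric] \<omega>_relations;
          simp add: mult.assoc tetrahedral_words_intros Q8_mult Q8_members)
  qed
qed

lemma icosahedral_wordsI: "k < 5 \<Longrightarrow> t \<in> tetrahedral_words \<Longrightarrow> \<sigma> ^ k * t \<in> icosahedral_words"
  unfolding icosahedral_words_def by force

lemma icosahedral_wordsE:
  assumes "u \<in> icosahedral_words"
  obtains t where "t \<in> tetrahedral_words" "u = t" | t where "t \<in> tetrahedral_words" "u = \<sigma> * t"
    | t where "t \<in> tetrahedral_words" "u = \<sigma>\<^sup>2 * t" | t where "t \<in> tetrahedral_words" "u = \<sigma> ^ 3 * t"
    | t where "t \<in> tetrahedral_words" "u = \<sigma> ^ 4 * t"
proof -
  obtain k t where "t \<in> tetrahedral_words" "k < 5" "u = \<sigma> ^ k * t"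
    using assms unfolding icosahedral_words_def by auto
  moreover from \<open>k < 5\<close> have "k = 0 \<or> k = 1 \<or> k = 2 \<or> k = 3 \<or> k = 4" by auto
  ultimately show thesis using that by auto
qed

lemma icosahedral_words_intros:
  assumes "t \<in> tetrahedral_words"
  shows "t \<in> icosahedral_words" "\<sigma> * t \<in> icosahedral_words" "\<sigma>\<^sup>2 * t \<in> icosahedral_words"
    "\<sigma> ^ 3 * t \<in> icosahedral_words" "\<sigma> ^ 4 * t \<in> icosahedral_words"
  using icosahedral_wordsI[of 0 t] icosahedral_wordsI[of 1 t] icosahedral_wordsI[of 2 t]
    icosahedral_wordsI[of 3 t] icosahedral_wordsI[of 4 t] assms by auto

lemma icosahedral_words_closed:
  assumes u: "u \<in> icosahedral_words"
  shows "q \<in> Q8 \<Longrightarrow> q * u \<in> icosahedral_words" "\<omega> * u \<in> icosahedral_words" "\<sigma> * u \<in> icosahedral_words"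
proof -
  have \<omega>2: "\<omega>\<^sup>2 * t \<in> tetrahedral_words" if "t \<in> tetrahedral_words" for t
    unfolding power2_eq_square mult.assoc by (intro tetrahedral_words_closed that)
  note cl = icosahedral_words_intros tetrahedral_words_closed \<omega>2 Q8_members
  have neg: "- t \<in> tetrahedral_words" if "t \<in> tetrahedral_words" for t
    using tetrahedral_words_closed(1)[OF that Q8_members(2)] by simp
  have negi: "- t \<in> icosahedral_words" if "t \<in> icosahedral_words" for t
    using that by (cases rule: icosahedral_wordsE; simp flip: mult_minus_right add: cl neg)
  have \<sigma>: "\<sigma> * (\<sigma> * t) = \<sigma>\<^sup>2 * t" "\<sigma> * (\<sigma>\<^sup>2 * t) = \<sigma> ^ 3 * t" "\<sigma> * (\<sigma> ^ 3 * t) = \<sigma> ^ 4 * t"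
    "\<sigma> * (\<sigma> ^ 4 * t) = \<sigma> ^ 5 * t" for t
    by (simp_all add: eval_nat_numeral mult.assoc)
  show "\<sigma> * u \<in> icosahedral_words"
    using u by (elim icosahedral_wordsE; simp add: \<sigma>; simp add: \<sigma>_powers(4) cl)
  show "\<omega> * u \<in> icosahedral_words"
    using u by (elim icosahedral_wordsE; simp add: mult.assoc[symmetric] \<sigma>_relations;
        simp add: mult.assoc cl negi)
  assume "q \<in> Q8"
  from _ _ this u show "q * u \<in> icosahedral_words"
  proof (rule closed_under_Q8)
    show "quat_i * u \<in> icosahedral_words" if "u \<in> icosahedral_words" for u
      using that by (elim icosahedral_wordsE; simp add: mult.assoc[symmetric] \<sigma>_relations;
          simp add: mult.assoc cl negi)
    show "quat_j * u \<in> icosahedral_words" if "u \<in> icosahedral_words" for u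
      using that by (elim icosahedral_wordsE; simp add: mult.assoc[symmetric] \<sigma>_relations;
          simp add: mult.assoc cl negi)
  qed
qed

lemma generators_nonzero: "Q8 \<union> {\<omega>, \<sigma>} \<subseteq> carrier quat_units"
proof -
  have "\<omega> \<noteq> 0" "\<sigma> \<noteq> 0" by (simp_all add: \<omega>_eq \<sigma>_eq quat_eq_iff)
  then show ?thesis using Q8_nonzero by auto
qed

lemma subgroup_\<I>: "subgroup \<I> quat_units"
  using group.generate_is_subgroup[OF group_quat_units generators_nonzero]
  by (simp add: binary_icosahedral_def)

lemma finite_tetrahedral_words: "finite tetrahedral_words" "card tetrahedral_words \<le> 24"
proof -
  show "finite tetrahedral_words" by (simp add: tetrahedral_words_def Q8_def)
  show "card tetrahedral_words \<le> 24"
    unfolding tetrahedral_words_def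
    by (rule order_trans[OF card_image_le]) (simp_all add: card_cartesian_product card_Q8, simp add: Q8_def)
qed

lemma \<I>_subset_words: "\<I> \<subseteq> icosahedral_words"
proof -
  have "generate quat_units (Q8 \<union> {\<omega>, \<sigma>}) \<subseteq> icosahedral_words"
  proof (rule group.generate_subset_of_closed_set[OF group_quat_units generators_nonzero])
    show "finite icosahedral_words"
      by (simp add: icosahedral_words_def finite_tetrahedral_words)
    show "icosahedral_words \<subseteq> carrier quat_units"
      using generators_nonzero by (auto simp: icosahedral_words_def tetrahedral_words_def simp del: zero_quat.simps)
    show "\<one>\<^bsub>quat_units\<^esub> \<in> icosahedral_words"
      by (simp add: icosahedral_words_intros tetrahedral_words_intros Q8_members)
  qed (auto simp: icosahedral_words_closed)
  then show ?thesis by (simp add: binary_icosahedral_def)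
qed

lemma finite_\<I>: "finite \<I>" and card_\<I>_le: "card \<I> \<le> 120"
proof -
  have fin: "finite icosahedral_words"
    by (simp add: icosahedral_words_def finite_tetrahedral_words)
  then show "finite \<I>" using \<I>_subset_words finite_subset by blast
  have "card \<I> \<le> card icosahedral_words" by (intro card_mono fin \<I>_subset_words)
  also have "\<dots> \<le> card ({..<5::nat} \<times> tetrahedral_words)"
    unfolding icosahedral_words_def by (intro card_image_le) (simp add: finite_tetrahedral_words)
  also have "\<dots> \<le> 120"
    using finite_tetrahedral_words by (simp add: card_cartesian_product)
  finally show "card \<I> \<le> 120" .
qed

lemma \<I>_gens: "Q8 \<subseteq> \<I>" "\<omega> \<in> \<I>" "\<sigma> \<in> \<I>"
  by (auto simp: binary_icosahedral_def intro: generate.incl)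

text \<open>
  The normal forms bound the order by 120 from above; $Q_8$, \<open>\<omega>\<close> and \<open>\<sigma>\<close> have orders 8, 3 and 5,
  which are pairwise coprime and divide it.
\<close>

lemma card_\<I>: "card \<I> = 120"
proof -
  have "8 dvd card \<I>"
    using card_subgroup_dvd[OF subgroup_Q8 subgroup_\<I> \<I>_gens(1)] by (simp add: card_Q8)
  moreover have "3 dvd card \<I>"
    by (rule prime_dvd_card_of_order[OF subgroup_\<I> finite_\<I> \<I>_gens(2)])
      (simp_all add: \<omega>_powers, simp add: \<omega>_eq quat_eq_iff)
  moreover have "5 dvd card \<I>"
    by (rule prime_dvd_card_of_order[OF subgroup_\<I> finite_\<I> \<I>_gens(3)])
      (simp_all add: \<sigma>_powers, simp add: \<sigma>_eq quat_eq_iff)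
  ultimately have "8 * (3 * 5) dvd card \<I>"
    by (intro divides_mult) (simp_all add: coprime_iff_gcd_eq_1 gcd_non_0_nat)
  moreover have "card \<I> > 0" using finite_\<I> \<I>_gens by (auto simp: card_gt_0_iff)
  ultimately show ?thesis using card_\<I>_le by (auto dest: dvd_imp_le)
qed

lemma \<I>_unit: "x \<in> \<I> \<Longrightarrow> sqnorm x = 1"
proof -
  assume x: "x \<in> \<I>"
  have "sqnorm x ^ n = sqnorm (x ^ n)" for n by (induction n) (simp_all add: sqnorm_mult)
  then have "sqnorm x ^ 120 = 1"
    using quat_subgroup_power_card[OF subgroup_\<I> finite_\<I> x] card_\<I> by simp
  moreover have "sqnorm x \<ge> 0" by (simp add: sqnorm_def)
  ultimately show "sqnorm x = 1" using power_eq_imp_eq_base[of "sqnorm x" 120 1] by simp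
qed

text \<open>
  The cosines of the multiples of 90, 60 and 36 degrees, which are the real parts of the unit quaternions
  of order dividing 4, 6 or 10.
\<close>

definition icosahedral_cosines :: "real set" where
  "icosahedral_cosines = {0, 1, -1, 1/2, -1/2, (1 + sqrt 5) / 4, - (1 + sqrt 5) / 4, (sqrt 5 - 1) / 4, - (sqrt 5 - 1) / 4}"

lemma card_icosahedral_cosines: "finite icosahedral_cosines" "card icosahedral_cosines \<le> 9"
proof -
  let ?xs = "[0, 1, -1, 1/2, -1/2, (1 + sqrt 5) / 4, - (1 + sqrt 5) / 4, (sqrt 5 - 1) / 4, - (sqrt 5 - 1) / 4]"
  have eq: "icosahedral_cosines = set ?xs" by (simp add: icosahedral_cosines_def)
  show "finite icosahedral_cosines" unfolding eq by simp
  show "card icosahedral_cosines \<le> 9" unfolding eq by (rule order_trans[OF card_length]) simp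
qed

lemma icosahedral_cosines_members:
  "0 \<in> icosahedral_cosines" "1 \<in> icosahedral_cosines" "1/2 \<in> icosahedral_cosines" "-1/2 \<in> icosahedral_cosines"
  "(1 + sqrt 5) / 4 \<in> icosahedral_cosines" "- (1 + sqrt 5) / 4 \<in> icosahedral_cosines"
  "(sqrt 5 - 1) / 4 \<in> icosahedral_cosines" "- (sqrt 5 - 1) / 4 \<in> icosahedral_cosines"
  by (simp_all only: icosahedral_cosines_def insert_iff simp_thms)

lemma \<sigma>_\<omega>_products:
  "\<sigma> * \<omega> = Quat (- (1 + sqrt 5) / 4) ((sqrt 5 - 1) / 4) (-1/2) 0"
  "\<sigma> * \<omega>\<^sup>2 = Quat (1/2) (- (1 + sqrt 5) / 4) (- (sqrt 5 - 1) / 4) 0"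
  "\<sigma>\<^sup>2 * \<omega> = Quat 0 (- (sqrt 5 - 1) / 4) (- (1 + sqrt 5) / 4) (-1/2)"
  "\<sigma>\<^sup>2 * \<omega>\<^sup>2 = Quat ((1 + sqrt 5) / 4) 0 ((sqrt 5 - 1) / 4) (1/2)"
  "\<sigma> ^ 3 * \<omega> = Quat ((1 + sqrt 5) / 4) (-1/2) 0 (- (sqrt 5 - 1) / 4)"
  "\<sigma> ^ 3 * \<omega>\<^sup>2 = Quat 0 ((1 + sqrt 5) / 4) (1/2) ((sqrt 5 - 1) / 4)"
  "\<sigma> ^ 4 * \<omega> = Quat (1/2) 0 ((1 + sqrt 5) / 4) ((sqrt 5 - 1) / 4)"
  "\<sigma> ^ 4 * \<omega>\<^sup>2 = Quat (- (1 + sqrt 5) / 4) (1/2) 0 (- (sqrt 5 - 1) / 4)"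
  by (simp_all only: \<omega>_powers \<sigma>_powers) (simp_all add: quat_eq_iff \<sigma>_eq \<omega>_eq field_simps)

text \<open>
  Right multiplication by an element of $Q_8$ permutes the coordinates of a quaternion up to sign, so
  only the coordinates of the fifteen products $\sigma^k \omega^l$ have to be inspected.
\<close>

lemma Re_\<I>:
  assumes "x \<in> \<I>" shows "Re_q x \<in> icosahedral_cosines"
proof -
  obtain k l q where x: "k < 5" "l < 3" "q \<in> Q8" "x = \<sigma> ^ k * (\<omega> ^ l * q)"
    using assms \<I>_subset_words unfolding icosahedral_words_def tetrahedral_words_def by auto
  have neg: "- c \<in> icosahedral_cosines" if "c \<in> icosahedral_cosines" for c
    using that by (auto simp: icosahedral_cosines_def)
  define y where "y = \<sigma> ^ k * \<omega> ^ l"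
  have "k = 0 \<or> k = 1 \<or> k = 2 \<or> k = 3 \<or> k = 4" "l = 0 \<or> l = 1 \<or> l = 2" using x by auto
  then have "Re_q y \<in> icosahedral_cosines \<and> Im_i y \<in> icosahedral_cosines \<and> Im_j y \<in> icosahedral_cosines
     \<and> Im_k y \<in> icosahedral_cosines"
    unfolding y_def
    by (elim disjE; simp only: power_0 power_one_right mult_1_left mult_1_right \<sigma>_\<omega>_products;
        (simp only: \<sigma>_powers \<omega>_powers)?;
        simp only: \<sigma>_eq \<omega>_eq quat.sel one_quat.simps icosahedral_cosines_members simp_thms)
  moreover have "Re_q x \<in> {Re_q y, - Re_q y, Im_i y, - Im_i y, Im_j y, - Im_j y, Im_k y, - Im_k y}"
    using x(3) unfolding x(4) mult.assoc[symmetric] y_def[symmetric] Q8_def by auto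
  ultimately show ?thesis by (elim conjE insertE emptyE) (simp_all only: neg)
qed

section \<open>Centralizers and normalizers in the binary icosahedral group\<close>

lemma \<I>_closed: "1 \<in> \<I>" "- 1 \<in> \<I>" "x \<in> \<I> \<Longrightarrow> y \<in> \<I> \<Longrightarrow> x * y \<in> \<I>" "x \<in> \<I> \<Longrightarrow> inverse x \<in> \<I>"
  "0 \<notin> \<I>"
  using quat_subgroupD[OF subgroup_\<I>] \<I>_gens(1) by (auto simp: Q8_def)

lemma \<I>_nonzero: "x \<in> \<I> \<Longrightarrow> x \<noteq> 0"
  using \<I>_closed(5) by auto

lemma real_in_\<I>: "x \<in> \<I> \<Longrightarrow> x \<in> range of_real \<Longrightarrow> x = 1 \<or> x = - 1"
  using \<I>_unit[of x] by (intro unit_quat_real) auto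

definition centralizer :: "quat \<Rightarrow> quat set" where
  "centralizer x = {y \<in> \<I>. y * x = x * y}"

lemma subgroup_centralizer: "subgroup (centralizer x) quat_units"
proof (rule group.subgroupI[OF group_quat_units])
  fix y z assume y: "y \<in> centralizer x" and z: "z \<in> centralizer x"
  then have y0: "y \<noteq> 0" and yx: "y * x = x * y" by (auto simp: centralizer_def \<I>_nonzero)
  have "inverse y * x = inverse y * (x * y) * inverse y" using y0 by (simp add: mult.assoc)
  also have "\<dots> = x * inverse y" using y0 by (simp add: yx[symmetric] mult.assoc[symmetric])
  finally have "inverse y * x = x * inverse y" .
  then show "inv\<^bsub>quat_units\<^esub> y \<in> centralizer x"
    using y y0 by (simp add: centralizer_def \<I>_closed)
  have "y * z * x = y * (x * z)" using z by (simp add: centralizer_def mult.assoc)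
  also have "\<dots> = x * (y * z)" using yx by (simp add: mult.assoc[symmetric])
  finally have "y * z * x = x * (y * z)" .
  then show "y \<otimes>\<^bsub>quat_units\<^esub> z \<in> centralizer x" using y z by (simp add: centralizer_def \<I>_closed)
qed (use \<I>_closed in \<open>auto simp: centralizer_def\<close>)

text \<open>
  The centralizer of a nonreal element is commutative, so it contains at most two elements with a given
  real part, hence at most 18 in total. Its order also is even, because of $-1$, and divides 120;
  this leaves at most 12.
\<close>

lemma card_centralizer:
  assumes x: "x \<in> \<I>" "x \<notin> range of_real"
  obtains d where "card (centralizer x) = 2 * d" "d \<le> 6"
proof -
  have sub: "centralizer x \<subseteq> \<I>" by (auto simp: centralizer_def)
  have fin: "finite (centralizer x)" using sub finite_\<I> finite_subset by blast
  define F where "F c = {y \<in> centralizer x. Re_q y = c}" for c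
  have F: "card (F c) \<le> 2" for c
  proof (cases "F c = {}")
    case False
    then obtain y where y: "y \<in> F c" by blast
    have "F c \<subseteq> {y, inverse y}"
    proof
      fix z assume z: "z \<in> F c"
      have yz: "y \<in> \<I>" "z \<in> \<I>" "Re_q z = Re_q y" using y z by (auto simp: F_def centralizer_def)
      have "y * z = z * y"
        by (rule centralizer_commutes[OF _ _ x(2)]) (use y z in \<open>auto simp: F_def centralizer_def\<close>)
      then show "z \<in> {y, inverse y}"
        using commuting_units_same_Re[OF \<I>_unit[OF yz(1)] \<I>_unit[OF yz(2)] _ yz(3)] by blast
    qed
    then have "card (F c) \<le> card {y, inverse y}" by (intro card_mono) auto
    also have "\<dots> \<le> 2" by (simp add: card_insert_if)
    finally show ?thesis .
  qed simp
  have "centralizer x = (\<Union>c\<in>icosahedral_cosines. F c)"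
    using sub Re_\<I> by (auto simp: F_def)
  then have "card (centralizer x) \<le> (\<Sum>c\<in>icosahedral_cosines. card (F c))"
    using card_UN_le[OF card_icosahedral_cosines(1)] by simp
  also have "\<dots> \<le> card icosahedral_cosines * 2" using sum_bounded_above[of icosahedral_cosines "\<lambda>c. card (F c)" 2] F by simp
  finally have le: "card (centralizer x) \<le> 18" using card_icosahedral_cosines(2) by simp
  have "(- 1 :: quat) \<noteq> 1" by (simp add: quat_eq_iff)
  then have "2 dvd card (centralizer x)"
    by (intro prime_dvd_card_of_order[OF subgroup_centralizer fin, of "- 1"])
      (auto simp: centralizer_def \<I>_closed)
  then obtain d where d: "card (centralizer x) = 2 * d" by (auto elim: dvdE)
  have "card (centralizer x) dvd 120"
    using card_subgroup_dvd[OF subgroup_centralizer subgroup_\<I> sub] card_\<I> by simp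
  then have "2 * d dvd 2 * 60" by (simp add: d)
  then have "d dvd 60" using nat_mult_dvd_cancel1[of 2 d 60] by simp
  moreover have "d = 7 \<or> d = 8 \<or> d = 9 \<or> d \<le> 6" using le d by auto
  ultimately have "d \<le> 6" by auto
  with d that show thesis by blast
qed

text \<open>
  The group \<open>K\<close> has odd order, so it is commutative and lies in the centralizer $C$ of any $x \neq 1$
  in \<open>K\<close>. The order of $C$ is \<open>2 * d\<close> with $d \le 6$, and the odd number $|K|$ divides $d$. An
  element that normalizes \<open>K\<close> sends $x$ to an element of \<open>K\<close> with the same real part, that is to $x$ or
  $x^{-1}$, so there are at most $2 |C| \le 24$ such elements.
\<close>

lemma card_subgroup_without_minus_one:
  assumes K: "subgroup K quat_units" "K \<subseteq> \<I>" "- 1 \<notin> K" "K \<noteq> {1}"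
    and N: "N \<subseteq> \<I>" "\<And>g k. g \<in> N \<Longrightarrow> k \<in> K \<Longrightarrow> g * k * inverse g \<in> K"
  shows "card K \<le> 5" "card N \<le> 24"
proof -
  note KD = quat_subgroupD[OF K(1)]
  have fin: "finite K" using K finite_\<I> finite_subset by blast
  have odd: "odd (card K)" by (rule odd_card_of_no_minus_one[OF K(1) fin K(3)])
  have comm: "y * z = z * y" if "y \<in> K" "z \<in> K" for y z
    using odd_unit_quat_subgroup_commutative[OF K(1) fin _ odd that] K(2) \<I>_unit by blast
  obtain x where x: "x \<in> K" "x \<noteq> 1" using K KD by blast
  have xI: "x \<in> \<I>" using x K by blast
  have nr: "x \<notin> range of_real" using real_in_\<I>[OF xI] x K by auto
  obtain d where d: "card (centralizer x) = 2 * d" "d \<le> 6" using card_centralizer[OF xI nr] .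
  have finC: "finite (centralizer x)" using finite_\<I> by (simp add: centralizer_def)
  have "K \<subseteq> centralizer x" using K comm x by (auto simp: centralizer_def)
  then have "card K dvd 2 * d"
    using card_subgroup_dvd[OF K(1) subgroup_centralizer] d by metis
  then have "card K dvd d" using odd by (simp add: coprime_dvd_mult_right_iff)
  moreover have "d > 0"
  proof (rule ccontr)
    assume "\<not> d > 0"
    then have "centralizer x = {}" using d finC by simp
    then show False using \<I>_closed by (auto simp: centralizer_def)
  qed
  ultimately have "card K \<le> 6" using d dvd_imp_le[of "card K" d] by linarith
  moreover have "card K \<noteq> 6" using odd by auto
  ultimately show "card K \<le> 5" by linarith
  have "card N \<le> card {x, inverse x} * card (centralizer x)"
  proof (rule group.card_le_card_fibres[OF group_quat_units, where \<phi> = "\<lambda>g. g * x * inverse g"])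
    show "N \<subseteq> carrier quat_units" using N \<I>_closed by auto
    show "g * x * inverse g \<in> {x, inverse x}" if g: "g \<in> N" for g
    proof -
      let ?y = "g * x * inverse g"
      have y: "?y \<in> K" using N g x by blast
      have "g \<noteq> 0" using g N \<I>_nonzero by auto
      then have re: "Re_q ?y = Re_q x"
        by (subst Re_q_mult_commute) (simp add: mult.assoc[symmetric] del: times_quat.simps)
      have "?y \<in> \<I>" using y K by blast
      then show ?thesis
        using commuting_units_same_Re[OF \<I>_unit[OF xI] \<I>_unit comm[OF x(1) y] re] by blast
    qed
    show "inv\<^bsub>quat_units\<^esub> g \<otimes>\<^bsub>quat_units\<^esub> h \<in> centralizer x"
      if gh: "g \<in> N" "h \<in> N" and eq: "g * x * inverse g = h * x * inverse h" for g h
    proof -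
      have nz: "g \<noteq> 0" "h \<noteq> 0" and I: "g \<in> \<I>" "h \<in> \<I>" using gh N \<I>_nonzero by auto
      have "inverse g * h * x = inverse g * (h * x * inverse h) * h" using nz by (simp add: mult.assoc)
      also have "\<dots> = x * (inverse g * h)"
        unfolding eq[symmetric] using nz by (simp add: mult.assoc[symmetric])
      finally show ?thesis using nz I by (simp add: centralizer_def \<I>_closed)
    qed
  qed (use finC in auto)
  also have "\<dots> \<le> 2 * (2 * d)"
    unfolding d(1) by (intro mult_right_mono) (simp_all add: card_insert_if)
  finally show "card N \<le> 24" using d by linarith
qed

section \<open>Subgroups of the direct square\<close>

lemma \<I>_simps [simp]: "x \<otimes>\<^bsub>binary_icosahedral\<^esub> y = x * y" "\<one>\<^bsub>binary_icosahedral\<^esub> = 1"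
  by (simp_all add: binary_icosahedral_def)

lemma inv_\<I>: "x \<in> \<I> \<Longrightarrow> inv\<^bsub>binary_icosahedral\<^esub> x = inverse x"
  by (rule group.inv_equality[OF group_binary_icosahedral]) (auto simp: \<I>_closed \<I>_nonzero)

abbreviation \<I>\<I> where "\<I>\<I> \<equiv> binary_icosahedral \<times>\<times> binary_icosahedral"

lemma group_\<I>\<I>: "group \<I>\<I>"
  by (intro DirProd_group group_binary_icosahedral)

lemma inv_\<I>\<I>: "x \<in> \<I> \<Longrightarrow> y \<in> \<I> \<Longrightarrow> inv\<^bsub>\<I>\<I>\<^esub> (x, y) = (inverse x, inverse y)"
  by (simp add: inv_DirProd group_binary_icosahedral inv_\<I>)

text \<open>
  Let $K_1$ and $K_2$ be the intersections of \<open>S\<close> with the two factors. They avoid $-1$, and each is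
  normalized by the corresponding projection of \<open>S\<close>. Moreover $|S| \le |\mathrm{pr}_2 S| \, |K_1|$ and
  $|S| \le |\mathrm{pr}_1 S| \, |K_2|$. If $K_1$ or $K_2$ is trivial, one of these bounds is at most
  $|\mathcal{I}| = 120$; otherwise the first one is at most $24 \cdot 5$.
\<close>

lemma card_subgroup_\<I>\<I>:
  assumes S: "subgroup S \<I>\<I>" "(1, - 1) \<notin> S" "(- 1, 1) \<notin> S"
  shows "card S \<le> 120"
proof -
  have SI: "a \<in> \<I> \<and> b \<in> \<I>" if "(a, b) \<in> S" for a b
    using subgroup.subset[OF S(1)] that by auto
  have one: "(1, 1) \<in> S" using subgroup.one_closed[OF S(1)] by simp
  have mult: "(a * c, b * d) \<in> S" if "(a, b) \<in> S" "(c, d) \<in> S" for a b c d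
    using subgroup.m_closed[OF S(1) that] by simp
  have inv: "(inverse a, inverse b) \<in> S" if "(a, b) \<in> S" for a b
    using subgroup.m_inv_closed[OF S(1) that] SI[OF that] by (simp add: inv_\<I>\<I>)
  have finS: "finite S"
    by (rule finite_subset[OF subgroup.subset[OF S(1)]]) (simp add: finite_\<I>)
  define K1 K2 where "K1 = {a. (a, 1) \<in> S}" and "K2 = {b. (1, b) \<in> S}"
  have nz: "(a, 1) \<in> S \<Longrightarrow> a \<noteq> 0" "(1, a) \<in> S \<Longrightarrow> a \<noteq> 0" "(0, 1) \<notin> S" "(1, 0) \<notin> S" for a
    using SI \<I>_nonzero by blast+
  have K1: "subgroup K1 quat_units"
    using SI one mult[of _ 1 _ 1] inv[of _ 1] nz
    by (intro group.subgroupI[OF group_quat_units]) (auto simp: K1_def)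
  have K2: "subgroup K2 quat_units"
    using SI one mult[of 1 _ 1] inv[of 1] nz
    by (intro group.subgroupI[OF group_quat_units]) (auto simp: K2_def)
  have KI: "K1 \<subseteq> \<I>" "K2 \<subseteq> \<I>" "- 1 \<notin> K1" "- 1 \<notin> K2" using SI S by (auto simp: K1_def K2_def)
  have fin: "finite K1" "finite K2" using KI finite_\<I> finite_subset by blast+
  have bound1: "card S \<le> card (snd ` S) * card K1"
  proof -
    have "card S \<le> card (snd ` S) * card ((\<lambda>a. (a, 1::quat)) ` K1)"
      using subgroup.subset[OF S(1)] finS fin
    proof (intro group.card_le_card_fibres[OF group_\<I>\<I>, where \<phi> = snd])
      fix s t assume "s \<in> S" "t \<in> S" "snd s = snd t"
      moreover obtain a b c where "s = (a, b)" "t = (c, b)" using \<open>snd s = snd t\<close> by (cases s, cases t) auto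
      ultimately show "inv\<^bsub>\<I>\<I>\<^esub> s \<otimes>\<^bsub>\<I>\<I>\<^esub> t \<in> (\<lambda>a. (a, 1)) ` K1"
        using SI[of a b] mult[OF inv[of a b], of c b] \<I>_closed(5) by (auto simp: inv_\<I>\<I> \<I>_nonzero K1_def)
    qed auto
    also have "card ((\<lambda>a. (a, 1::quat)) ` K1) = card K1" by (intro card_image) (auto simp: inj_on_def)
    finally show ?thesis .
  qed
  have bound2: "card S \<le> card (fst ` S) * card K2"
  proof -
    have "card S \<le> card (fst ` S) * card ((\<lambda>b. (1::quat, b)) ` K2)"
      using subgroup.subset[OF S(1)] finS fin
    proof (intro group.card_le_card_fibres[OF group_\<I>\<I>, where \<phi> = fst])
      fix s t assume "s \<in> S" "t \<in> S" "fst s = fst t"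
      moreover obtain a b c where "s = (b, a)" "t = (b, c)" using \<open>fst s = fst t\<close> by (cases s, cases t) auto
      ultimately show "inv\<^bsub>\<I>\<I>\<^esub> s \<otimes>\<^bsub>\<I>\<I>\<^esub> t \<in> (\<lambda>b. (1, b)) ` K2"
        using SI[of b a] mult[OF inv[of b a], of b c] \<I>_closed(5) by (auto simp: inv_\<I>\<I> \<I>_nonzero K2_def)
    qed auto
    also have "card ((\<lambda>b. (1::quat, b)) ` K2) = card K2" by (intro card_image) (auto simp: inj_on_def)
    finally show ?thesis .
  qed
  have proj: "fst ` S \<subseteq> \<I>" "snd ` S \<subseteq> \<I>" using SI by auto
  then have proj120: "card (fst ` S) \<le> 120" "card (snd ` S) \<le> 120"
    using card_mono[OF finite_\<I>] card_\<I> by metis+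
  consider "K1 = {1}" | "K2 = {1}" | "K1 \<noteq> {1}" "K2 \<noteq> {1}" by blast
  then show ?thesis
  proof cases
    case 1 then show ?thesis using bound1 proj120 by simp
  next
    case 2 then show ?thesis using bound2 proj120 by simp
  next
    case 3
    have "g * k * inverse g \<in> K2" if g: "g \<in> snd ` S" and k: "k \<in> K2" for g k
    proof -
      from g obtain a where a: "(a, g) \<in> S" by auto
      have "(a * 1 * inverse a, g * k * inverse g) \<in> S"
        using k by (intro mult a inv) (simp add: K2_def)
      moreover have "a \<noteq> 0" using SI[OF a] \<I>_nonzero by auto
      ultimately show ?thesis by (simp add: K2_def)
    qed
    then have "card (snd ` S) \<le> 24"
      by (rule card_subgroup_without_minus_one(2)[OF K2 KI(2,4) 3(2) proj(2)])
    moreover have "card K1 \<le> 5"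
      by (rule card_subgroup_without_minus_one(1)[OF K1 KI(1,3) 3(1), of "{}"]) auto
    ultimately have "card (snd ` S) * card K1 \<le> 24 * 5" by (rule mult_le_mono)
    with bound1 show ?thesis by linarith
  qed
qed

section \<open>The minimal degree of the central square\<close>

abbreviation central_diagonal :: "(quat \<times> quat) set" where
  "central_diagonal \<equiv> {(z, z) | z. z \<in> center binary_icosahedral}"

text \<open>
  The pair $(a, b)$ acts on the 120 elements of $\mathcal{I}$ by $x \mapsto a x b^{-1}$. Fixing $x = 1$
  forces $a = b$, and then fixing every $x$ forces $a$ to be central.
\<close>

lemma central_square_embeds:
  "\<exists>f. f \<in> mon (central_square binary_icosahedral) (sym_group 120)"
proof -
  define J where "J = {1..120::nat}"
  obtain e where e: "bij_betw e J \<I>"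
    using ex_bij_betw_nat_finite_1[OF finite_\<I>] card_\<I> by (auto simp: J_def)
  define e' where "e' = inv_into J e"
  have e': "bij_betw e' \<I> J" unfolding e'_def by (rule bij_betw_inv_into[OF e])
  have ee': "e (e' x) = x" if "x \<in> \<I>" for x
    unfolding e'_def by (rule bij_betw_inv_into_right[OF e that])
  have e'e: "e' (e n) = n" if "n \<in> J" for n
    unfolding e'_def by (rule bij_betw_inv_into_left[OF e that])
  have eI: "e n \<in> \<I>" if "n \<in> J" for n using bij_betw_apply[OF e that] .
  have e'I: "e' x \<in> J" if "x \<in> \<I>" for x using bij_betw_apply[OF e' that] .
  define act where "act s n = (if n \<in> J then e' (fst s * e n * inverse (snd s)) else n)" for s n
  have act_act: "act (a, b) (act (c, d) n) = act (a * c, b * d) n"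
    if I: "a \<in> \<I>" "b \<in> \<I>" "c \<in> \<I>" "d \<in> \<I>" for a b c d n
  proof (cases "n \<in> J")
    case True
    have "c * e n * inverse d \<in> \<I>" using I eI[OF True] by (intro \<I>_closed)
    with True show ?thesis
      using I e'I ee' by (simp add: act_def nonzero_inverse_mult_distrib \<I>_nonzero mult.assoc)
  qed (simp add: act_def)
  have act_1: "act (1, 1) = id" by (auto simp: act_def e'e)
  have permutes: "act (a, b) permutes J" if I: "a \<in> \<I>" "b \<in> \<I>" for a b
  proof (rule bij_imp_permutes)
    have inv: "act (inverse a, inverse b) (act (a, b) n) = n" "act (a, b) (act (inverse a, inverse b) n) = n" for n
      using I \<I>_closed act_1 \<I>_nonzero by (simp_all add: act_act)
    have into: "act (c, d) n \<in> J" if "c \<in> \<I>" "d \<in> \<I>" "n \<in> J" for c d n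
      using that e'I eI \<I>_closed by (simp add: act_def)
    show "bij_betw (act (a, b)) J J"
      by (rule bij_betw_byWitness[where f' = "act (inverse a, inverse b)"])
        (use inv into I \<I>_closed in auto)
  qed (auto simp: act_def)
  have hom: "act \<in> hom \<I>\<I> (sym_group 120)"
    by (rule homI) (use permutes[unfolded J_def] in \<open>auto simp: sym_group_def act_act fun_eq_iff\<close>)
  interpret act: group_hom \<I>\<I> "sym_group 120" act
    using hom group_\<I>\<I> sym_group_is_group by (simp add: group_hom_def group_hom_axioms_def)
  have "kernel \<I>\<I> (sym_group 120) act = central_diagonal"
  proof (intro equalityI subsetI)
    fix s assume "s \<in> kernel \<I>\<I> (sym_group 120) act"
    then obtain a b where s: "s = (a, b)" "a \<in> \<I>" "b \<in> \<I>" and id: "act (a, b) = id"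
      by (auto simp: kernel_def sym_group_def)
    have fixed: "a * x * inverse b = x" if x: "x \<in> \<I>" for x
    proof -
      have "e (act (a, b) (e' x)) = a * x * inverse b"
        using s x e'I[OF x] by (simp add: act_def ee' \<I>_closed)
      then show ?thesis using x by (simp add: id ee')
    qed
    have comm: "a * x = x * b" if "x \<in> \<I>" for x
    proof -
      have "a * x * inverse b * b = x * b" by (simp only: fixed[OF that])
      then show ?thesis using s \<I>_nonzero by (simp add: mult.assoc)
    qed
    from comm[of 1] have "a = b" by (simp add: \<I>_closed)
    with comm s show "s \<in> central_diagonal" by (auto simp: center_def)
  next
    fix s assume "s \<in> central_diagonal"
    then obtain z where s: "s = (z, z)" "z \<in> \<I>" and comm: "\<And>x. x \<in> \<I> \<Longrightarrow> z * x = x * z"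
      by (auto simp: center_def)
    have "act (z, z) n = n" for n
      using s comm eI[of n] \<I>_nonzero e'e by (simp add: act_def mult.assoc)
    then show "s \<in> kernel \<I>\<I> (sym_group 120) act"
      using s by (auto simp: kernel_def sym_group_def fun_eq_iff)
  qed
  with act.FactGroup_hom act.FactGroup_inj_on show ?thesis
    unfolding central_square_def mon_def by auto
qed

text \<open>
  Under a faithful action some point is moved by the class of $(1,-1)$, which is also the class of
  $(-1,1)$. Hence its stabilizer in $\mathcal{I} \times \mathcal{I}$ contains neither of these two
  pairs and has at most 120 elements, so its orbit has at least $120^2 / 120$ points.
\<close>

lemma degree_ge_120:
  assumes f: "f \<in> mon (central_square binary_icosahedral) (sym_group m)"
  shows "120 \<le> m"
proof -
  note normal = central_diagonal_normal[OF group_binary_icosahedral]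
  interpret D: normal central_diagonal \<I>\<I> by (rule normal)
  interpret Sm: group "sym_group m" by (rule sym_group_is_group)
  let ?\<pi> = "\<lambda>s. central_diagonal #>\<^bsub>\<I>\<I>\<^esub> s"
  \<comment> \<open>The action is pulled back to \<open>\<I>\<I>\<close>, where the point stabilizers are honest subgroups of a direct
    product.\<close>
  define P where "P = f \<circ> ?\<pi>"
  have f_hom: "f \<in> hom (\<I>\<I> Mod central_diagonal) (sym_group m)"
    using f by (simp add: mon_def central_square_def)
  have "P \<in> hom \<I>\<I> (sym_group m)"
    unfolding P_def by (rule hom_compose[OF D.r_coset_hom_Mod f_hom])
  then interpret P: group_hom \<I>\<I> "sym_group m" P
    using group_\<I>\<I> by (simp add: group_hom_def group_hom_axioms_def Sm.is_group)
  have P_mult: "P (s \<otimes>\<^bsub>\<I>\<I>\<^esub> t) x = P s (P t x)" if "s \<in> \<I> \<times> \<I>" "t \<in> \<I> \<times> \<I>" for s t x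
    using P.hom_mult[of s t] that by (simp add: sym_group_def)
  have P_one: "P (1, 1) x = x" for x
    using P.hom_one by (simp add: sym_group_def)
  have P_perm: "P s permutes {1..m}" if "s \<in> \<I> \<times> \<I>" for s
    using P.hom_closed[of s] that by (simp add: sym_group_def)
  have ker: "P s = id \<longleftrightarrow> s \<in> central_diagonal" if s: "s \<in> \<I> \<times> \<I>" for s
  proof
    assume "P s = id"
    then have "f (?\<pi> s) = \<one>\<^bsub>sym_group m\<^esub>" by (simp add: P_def sym_group_def)
    moreover have "?\<pi> s \<in> carrier (central_square binary_icosahedral)"
      using s D.rcosetsI[of central_diagonal s] D.subset by (auto simp: central_square_def FactGroup_def)
    ultimately have "?\<pi> s = \<one>\<^bsub>central_square binary_icosahedral\<^esub>"
      using f mon_iff_hom_one[OF group_central_square[OF group_binary_icosahedral] sym_group_is_group]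
      by blast
    then have "?\<pi> s = central_diagonal" by (simp add: central_square_def)
    moreover have "s \<in> ?\<pi> s" using s D.rcos_self[OF _ D.is_subgroup] by simp
    ultimately show "s \<in> central_diagonal" by simp
  next
    assume "s \<in> central_diagonal"
    then have "?\<pi> s = \<one>\<^bsub>\<I>\<I> Mod central_diagonal\<^esub>"
      using D.rcos_const[OF D.is_group, of s] by simp
    then show "P s = id"
      using hom_one[OF f_hom D.factorgroup_is_group sym_group_is_group] by (simp add: P_def sym_group_def)
  qed
  have neg: "(- 1 :: quat) \<noteq> 1" by (simp add: quat_eq_iff)
  have "P (1, - 1) \<noteq> id" using ker[of "(1, - 1)"] neg by (auto simp: \<I>_closed)
  then obtain p where p: "P (1, - 1) p \<noteq> p" by (auto simp: fun_eq_iff)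
  then have pm: "p \<in> {1..m}" using permutes_not_in[OF P_perm[of "(1, - 1)"], of p] by (auto simp: \<I>_closed)
  have p': "P (- 1, 1) p \<noteq> p"
  proof -
    have "P (- 1, - 1) = id" using ker[of "(- 1, - 1)"] by (auto simp: \<I>_closed center_def)
    then have "P (- 1, 1) p = P (1, - 1) p"
      using P_mult[of "(- 1, - 1)" "(1, - 1)" p] by (simp add: \<I>_closed)
    with p show ?thesis by simp
  qed
  define S where "S = {s \<in> \<I> \<times> \<I>. P s p = p}"
  have inv_fix: "P (inv\<^bsub>\<I>\<I>\<^esub> s) y = x" if "s \<in> \<I> \<times> \<I>" "P s x = y" for s x y
    using P_mult[of "inv\<^bsub>\<I>\<I>\<^esub> s" s x] that P_one D.inv_closed[of s] D.l_inv[of s] by simp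
  have S: "subgroup S \<I>\<I>"
  proof (rule D.subgroupI)
    show "S \<noteq> {}" using P_one by (auto simp: S_def \<I>_closed intro!: exI[of _ 1])
    show "inv\<^bsub>\<I>\<I>\<^esub> s \<in> S" if "s \<in> S" for s
      using that inv_fix D.inv_closed[of s] by (simp add: S_def)
    show "s \<otimes>\<^bsub>\<I>\<I>\<^esub> t \<in> S" if "s \<in> S" "t \<in> S" for s t
      using that P_mult[of s t p] D.m_closed[of s t] by (simp add: S_def)
  qed (auto simp: S_def)
  have S120: "card S \<le> 120"
    by (rule card_subgroup_\<I>\<I>[OF S]) (use p p' in \<open>auto simp: S_def\<close>)
  have "card (\<I> \<times> \<I>) \<le> card {1..m} * card S"
  proof (rule D.card_le_card_fibres)
    show "P s p \<in> {1..m}" if "s \<in> \<I> \<times> \<I>" for s using permutes_in_image[OF P_perm[OF that]] pm by blast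
    show "inv\<^bsub>\<I>\<I>\<^esub> s \<otimes>\<^bsub>\<I>\<I>\<^esub> t \<in> S" if st: "s \<in> \<I> \<times> \<I>" "t \<in> \<I> \<times> \<I>" and eq: "P s p = P t p" for s t
    proof -
      have "inv\<^bsub>\<I>\<I>\<^esub> s \<in> \<I> \<times> \<I>" using D.inv_closed[of s] st by simp
      then show ?thesis
        using st P_mult[of "inv\<^bsub>\<I>\<I>\<^esub> s" t p] inv_fix[OF st(1) eq] D.m_closed[of "inv\<^bsub>\<I>\<I>\<^esub> s" t]
        by (simp add: S_def)
    qed
    show "finite S" using finite_\<I> by (simp add: S_def)
  qed auto
  also have "\<dots> \<le> m * 120" using S120 by simp
  finally have "120 * 120 \<le> m * 120"
    by (simp add: card_cartesian_product card_\<I>)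
  then show ?thesis by simp
qed

theorem proposition4p14:
  shows "min_perm_degree (central_square binary_icosahedral) = 120"
  unfolding min_perm_degree_def
  using central_square_embeds degree_ge_120 by (intro Least_equality) auto

end
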